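(* Let $(\mathcal{M},\phi,\xi,\eta,g)$ be an almost paracontact almost paracomplex Riemannian manifold. Then its fundamental tensor $F$ is expressed by the Nijenhuis tensor $N$ and the associated Nijenhuis tensor $\widehat N$ by $$\begin{aligned}F(x,y,z)={}&\tfrac14\bigl[N(\phi x,y,z)+N(\phi x,z,y)+\widehat N(\phi x,y,z)+\widehat N(\phi x,z,y)\bigr]\\&-\tfrac12\eta(x)\bigl[N(\xi,y,\phi z)+\widehat N(\xi,y,\phi z)+\eta(z)\widehat N(\xi,\xi,\phi y)\bigr]\end{aligned}$$ for all $x,y,z$.
   Context: Let $n\ge 1$. An almost paracontact almost paracomplex Riemannian manifold $(\mathcal{M},\phi,\xi,\eta,g)$ is a $(2n+1)$-dimensional smooth manifold with a $(1,1)$-tensor field $\phi$, a vector field $\xi$ and a 1-form $\eta$ such that $\phi\xi=0$, $\phi^2=I-\eta\otimes\xi$, $\eta\circ\phi=0$, $\eta(\xi)=1$, $\mathrm{tr}\,\phi=0$, and a Riemannian metric $g$ with $g(\phi x,\phi y)=g(x,y)-\eta(x)\eta(y)$, $g(x,\xi)=\eta(x)$. With $\nabla$ the Levi-Civita connection of $g$, $F(x,y,z)=g((\nabla_x\phi)y,z)$. Put $[\phi,\phi](x,y)=[\phi x,\phi y]+\phi^2[x,y]-\phi[\phi x,y]-\phi[x,\phi y]$ and $d\eta(x,y)=(\nabla_x\eta)y-(\nabla_y\eta)x$. The Nijenhuis tensor is $N(x,y)=[\phi,\phi](x,y)-d\eta(x,y)\xi$. Put $\{x,y\}=\nabla_xy+\nabla_yx$,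 $\{\phi,\phi\}(x,y)=\{\phi x,\phi y\}+\phi^2\{x,y\}-\phi\{\phi x,y\}-\phi\{x,\phi y\}$ and $(\mathfrak{L}_\xi g)(x,y)=(\nabla_x\eta)y+(\nabla_y\eta)x$. The associated Nijenhuis tensor is $\widehat N(x,y)=\{\phi,\phi\}(x,y)-(\mathfrak{L}_\xi g)(x,y)\xi$. As $(0,3)$-tensors, $N(x,y,z)=g(N(x,y),z)$ and $\widehat N(x,y,z)=g(\widehat N(x,y),z)$. *)

theory Defs
  imports "HOL-Analysis.Analysis" "HOL-Library.Function_Algebras"
begin

text \<open>Tangent vectors are modelled as derivations, that is, as elements of a function space.
  The pointwise scalar multiplication makes the library's linear algebra (\<open>span\<close>, \<open>independent\<close>,
  \<open>representation\<close>) available for them; addition comes from Function_Algebras.\<close>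

instantiation "fun" :: (type, real_vector) real_vector
begin

definition scaleR_fun :: "real \<Rightarrow> ('a \<Rightarrow> 'b) \<Rightarrow> 'a \<Rightarrow> 'b" where
  "scaleR_fun c f = (\<lambda>x. c *\<^sub>R f x)"

instance
  by standard (auto simp: scaleR_fun_def fun_eq_iff algebra_simps)

end


section \<open>Smooth manifolds\<close>

text \<open>The next two notions are meant for open \<open>U\<close>.\<close>

fun Ck_on :: "nat \<Rightarrow> 'e::real_normed_vector set \<Rightarrow> ('e \<Rightarrow> 'f::real_normed_vector) \<Rightarrow> bool" where
  "Ck_on 0 U f \<longleftrightarrow> continuous_on U f"
| "Ck_on (Suc k) U f \<longleftrightarrow>
     (\<forall>x\<in>U. f differentiable (at x)) \<and> (\<forall>v. Ck_on k U (\<lambda>x. frechet_derivative f (at x) v))"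

definition smooth_on :: "'e::real_normed_vector set \<Rightarrow> ('e \<Rightarrow> 'f::real_normed_vector) \<Rightarrow> bool" where
  "smooth_on U f \<longleftrightarrow> (\<forall>k. Ck_on k U f)"

text \<open>The manifold is the whole type \<open>'a\<close> with its Hausdorff, second countable topology. A chart is
  a pair \<open>(U, c)\<close> of a domain and a coordinate map, which is relevant only on \<open>U\<close>.\<close>

type_synonym ('a, 'e) atlas = "('a set \<times> ('a \<Rightarrow> 'e)) set"

definition smooth_atlas ::
    "('a::{t2_space, second_countable_topology}, 'e::euclidean_space) atlas \<Rightarrow> bool" where
  "smooth_atlas \<A> \<longleftrightarrow>
     (\<forall>(U, c)\<in>\<A>. open U \<and> open (c ` U) \<and> homeomorphism U (c ` U) c (inv_into U c)) \<and>
     (\<Union>(U, c)\<in>\<A>. U) = UNIV \<and>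
     (\<forall>(U, c)\<in>\<A>. \<forall>(V, d)\<in>\<A>. smooth_on (c ` (U \<inter> V)) (d \<circ> inv_into U c))"

definition smooth_functions :: "('a, 'e::euclidean_space) atlas \<Rightarrow> ('a \<Rightarrow> real) set" where
  "smooth_functions \<A> = {f. \<forall>(U, c)\<in>\<A>. smooth_on (c ` U) (f \<circ> inv_into U c)}"

type_synonym 'a tvec = "('a \<Rightarrow> real) \<Rightarrow> real"
type_synonym 'a vfield = "'a \<Rightarrow> 'a tvec"

text \<open>A tangent vector is a derivation of the smooth functions; it is required to vanish on
  non-smooth functions so that equality of tangent vectors is equality of HOL functions.\<close>

definition tangent_space :: "('a, 'e::euclidean_space) atlas \<Rightarrow> 'a \<Rightarrow> 'a tvec set" where
  "tangent_space \<A> p = {v.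
     (\<forall>f\<in>smooth_functions \<A>. \<forall>h\<in>smooth_functions \<A>.
        v (\<lambda>q. f q + h q) = v f + v h \<and>
        v (\<lambda>q. f q * h q) = v f * h p + f p * v h) \<and>
     (\<forall>a. \<forall>f\<in>smooth_functions \<A>. v (\<lambda>q. a * f q) = a * v f) \<and>
     (\<forall>f. f \<notin> smooth_functions \<A> \<longrightarrow> v f = 0)}"

definition vderiv :: "'a vfield \<Rightarrow> ('a \<Rightarrow> real) \<Rightarrow> 'a \<Rightarrow> real" where
  "vderiv X f = (\<lambda>p. X p f)"

definition vector_fields :: "('a, 'e::euclidean_space) atlas \<Rightarrow> 'a vfield set" where
  "vector_fields \<A> = {X. (\<forall>p. X p \<in> tangent_space \<A> p) \<and>
     (\<forall>f\<in>smooth_functions \<A>. vderiv X f \<in> smooth_functions \<A>)}"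

definition lie_bracket :: "'a vfield \<Rightarrow> 'a vfield \<Rightarrow> 'a vfield" where
  "lie_bracket X Y = (\<lambda>p f. X p (vderiv Y f) - Y p (vderiv X f))"


section \<open>Tensor fields and connections\<close>

definition linear_map_on :: "'v::real_vector set \<Rightarrow> ('v \<Rightarrow> 'w::real_vector) \<Rightarrow> bool" where
  "linear_map_on V L \<longleftrightarrow>
     (\<forall>u\<in>V. \<forall>v\<in>V. L (u + v) = L u + L v) \<and> (\<forall>a. \<forall>v\<in>V. L (a *\<^sub>R v) = a *\<^sub>R L v)"

text \<open>The value does not depend on the chosen basis when \<open>V\<close> is a finite-dimensional subspace and
  \<open>L\<close> a linear endomorphism of it.\<close>

definition trace_on :: "'v::real_vector set \<Rightarrow> ('v \<Rightarrow> 'v) \<Rightarrow> real" where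
  "trace_on V L = (let B = (SOME B. independent B \<and> span B = V) in
     \<Sum>b\<in>B. representation B (L b) b)"

text \<open>Pointwise application of a field of maps, used for both (1,1)-tensor fields and 1-forms.\<close>

definition app_field :: "('a \<Rightarrow> 'b \<Rightarrow> 'c) \<Rightarrow> ('a \<Rightarrow> 'b) \<Rightarrow> 'a \<Rightarrow> 'c" (infixr "\<rhd>" 80) where
  "T \<rhd> X = (\<lambda>p. T p (X p))"

definition fscale :: "('a \<Rightarrow> real) \<Rightarrow> 'a vfield \<Rightarrow> 'a vfield" (infixr "*\<^sub>F" 75) where
  "f *\<^sub>F X = (\<lambda>p. f p *\<^sub>R X p)"

type_synonym 'a endo_field = "'a \<Rightarrow> 'a tvec \<Rightarrow> 'a tvec"
type_synonym 'a one_form = "'a \<Rightarrow> 'a tvec \<Rightarrow> real"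
type_synonym 'a bilin_field = "'a \<Rightarrow> 'a tvec \<Rightarrow> 'a tvec \<Rightarrow> real"

definition field_pairing :: "'a bilin_field \<Rightarrow> 'a vfield \<Rightarrow> 'a vfield \<Rightarrow> 'a \<Rightarrow> real" where
  "field_pairing g X Y = (\<lambda>p. g p (X p) (Y p))"

definition endo_fields :: "('a, 'e::euclidean_space) atlas \<Rightarrow> 'a endo_field set" where
  "endo_fields \<A> = {\<phi>.
     (\<forall>p. linear_map_on (tangent_space \<A> p) (\<phi> p) \<and>
          \<phi> p ` tangent_space \<A> p \<subseteq> tangent_space \<A> p) \<and>
     (\<forall>X\<in>vector_fields \<A>. \<phi> \<rhd> X \<in> vector_fields \<A>)}"

definition one_forms :: "('a, 'e::euclidean_space) atlas \<Rightarrow> 'a one_form set" where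
  "one_forms \<A> = {\<eta>.
     (\<forall>p. linear_map_on (tangent_space \<A> p) (\<eta> p)) \<and>
     (\<forall>X\<in>vector_fields \<A>. \<eta> \<rhd> X \<in> smooth_functions \<A>)}"

definition riemannian_metric :: "('a, 'e::euclidean_space) atlas \<Rightarrow> 'a bilin_field \<Rightarrow> bool" where
  "riemannian_metric \<A> g \<longleftrightarrow>
     (\<forall>p. \<forall>u\<in>tangent_space \<A> p.
        linear_map_on (tangent_space \<A> p) (g p u) \<and>
        (\<forall>v\<in>tangent_space \<A> p. g p u v = g p v u) \<and>
        (u \<noteq> 0 \<longrightarrow> g p u u > 0)) \<and>
     (\<forall>X\<in>vector_fields \<A>. \<forall>Y\<in>vector_fields \<A>. field_pairing g X Y \<in> smooth_functions \<A>)"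

type_synonym 'a connection = "'a vfield \<Rightarrow> 'a vfield \<Rightarrow> 'a vfield"

definition affine_connection :: "('a, 'e::euclidean_space) atlas \<Rightarrow> 'a connection \<Rightarrow> bool" where
  "affine_connection \<A> D \<longleftrightarrow>
     (\<forall>X\<in>vector_fields \<A>. \<forall>Y\<in>vector_fields \<A>. D X Y \<in> vector_fields \<A>) \<and>
     (\<forall>X\<in>vector_fields \<A>. \<forall>Y\<in>vector_fields \<A>. \<forall>Z\<in>vector_fields \<A>.
        D (X + Y) Z = D X Z + D Y Z \<and> D X (Y + Z) = D X Y + D X Z) \<and>
     (\<forall>f\<in>smooth_functions \<A>. \<forall>X\<in>vector_fields \<A>. \<forall>Y\<in>vector_fields \<A>.
        D (f *\<^sub>F X) Y = f *\<^sub>F D X Y \<and>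
        D X (f *\<^sub>F Y) = vderiv X f *\<^sub>F Y + f *\<^sub>F D X Y)"

definition levi_civita ::
    "('a, 'e::euclidean_space) atlas \<Rightarrow> 'a bilin_field \<Rightarrow> 'a connection \<Rightarrow> bool" where
  "levi_civita \<A> g D \<longleftrightarrow>
     affine_connection \<A> D \<and>
     (\<forall>X\<in>vector_fields \<A>. \<forall>Y\<in>vector_fields \<A>. D X Y - D Y X = lie_bracket X Y) \<and>
     (\<forall>X\<in>vector_fields \<A>. \<forall>Y\<in>vector_fields \<A>. \<forall>Z\<in>vector_fields \<A>.
        vderiv X (field_pairing g Y Z) = field_pairing g (D X Y) Z + field_pairing g Y (D X Z))"

definition cov_endo ::
    "'a connection \<Rightarrow> 'a endo_field \<Rightarrow> 'a vfield \<Rightarrow> 'a vfield \<Rightarrow> 'a vfield" where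
  "cov_endo D \<phi> X Y = D X (\<phi> \<rhd> Y) - (\<phi> \<rhd> D X Y)"

definition cov_form ::
    "'a connection \<Rightarrow> 'a one_form \<Rightarrow> 'a vfield \<Rightarrow> 'a vfield \<Rightarrow> 'a \<Rightarrow> real" where
  "cov_form D \<eta> X Y = vderiv X (\<eta> \<rhd> Y) - (\<eta> \<rhd> D X Y)"


section \<open>Almost paracontact almost paracomplex Riemannian manifolds\<close>

definition almost_paracontact_paracomplex_riemannian ::
    "nat \<Rightarrow> ('a::{t2_space, second_countable_topology}, 'e::euclidean_space) atlas \<Rightarrow>
     'a endo_field \<Rightarrow> 'a vfield \<Rightarrow> 'a one_form \<Rightarrow> 'a bilin_field \<Rightarrow> bool" where
  "almost_paracontact_paracomplex_riemannian n \<A> \<phi> \<xi> \<eta> g \<longleftrightarrow>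
     n \<ge> 1 \<and> DIM('e) = 2 * n + 1 \<and> smooth_atlas \<A> \<and>
     \<phi> \<in> endo_fields \<A> \<and> \<xi> \<in> vector_fields \<A> \<and> \<eta> \<in> one_forms \<A> \<and> riemannian_metric \<A> g \<and>
     (\<forall>p. \<phi> p (\<xi> p) = 0 \<and> \<eta> p (\<xi> p) = 1 \<and> trace_on (tangent_space \<A> p) (\<phi> p) = 0 \<and>
        (\<forall>u\<in>tangent_space \<A> p.
           \<phi> p (\<phi> p u) = u - \<eta> p u *\<^sub>R \<xi> p \<and>
           \<eta> p (\<phi> p u) = 0 \<and>
           g p u (\<xi> p) = \<eta> p u \<and>
           (\<forall>v\<in>tangent_space \<A> p. g p (\<phi> p u) (\<phi> p v) = g p u v - \<eta> p u * \<eta> p v)))"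

definition fundamental_tensor ::
    "'a endo_field \<Rightarrow> 'a bilin_field \<Rightarrow> 'a connection \<Rightarrow>
     'a vfield \<Rightarrow> 'a vfield \<Rightarrow> 'a vfield \<Rightarrow> 'a \<Rightarrow> real" where
  "fundamental_tensor \<phi> g D x y z = field_pairing g (cov_endo D \<phi> x y) z"

text \<open>For \<open>B\<close> the Lie bracket this is \<open>[\<phi>,\<phi>]\<close>, for \<open>B\<close> the symmetric bracket it is \<open>{\<phi>,\<phi>}\<close>.\<close>

definition phi_phi_bracket ::
    "('a vfield \<Rightarrow> 'a vfield \<Rightarrow> 'a vfield) \<Rightarrow> 'a endo_field \<Rightarrow>
     'a vfield \<Rightarrow> 'a vfield \<Rightarrow> 'a vfield" where
  "phi_phi_bracket B \<phi> x y =
     B (\<phi> \<rhd> x) (\<phi> \<rhd> y) + (\<phi> \<rhd> \<phi> \<rhd> B x y) - (\<phi> \<rhd> B (\<phi> \<rhd> x) y) - (\<phi> \<rhd> B x (\<phi> \<rhd> y))"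

definition sym_bracket :: "'a connection \<Rightarrow> 'a vfield \<Rightarrow> 'a vfield \<Rightarrow> 'a vfield" where
  "sym_bracket D x y = D x y + D y x"

definition d_form ::
    "'a connection \<Rightarrow> 'a one_form \<Rightarrow> 'a vfield \<Rightarrow> 'a vfield \<Rightarrow> 'a \<Rightarrow> real" where
  "d_form D \<eta> x y = cov_form D \<eta> x y - cov_form D \<eta> y x"

text \<open>The Lie derivative of \<open>g\<close> along \<open>\<xi>\<close>, for \<open>\<eta>\<close> the 1-form dual to \<open>\<xi>\<close>.\<close>

definition lie_metric ::
    "'a connection \<Rightarrow> 'a one_form \<Rightarrow> 'a vfield \<Rightarrow> 'a vfield \<Rightarrow> 'a \<Rightarrow> real" where
  "lie_metric D \<eta> x y = cov_form D \<eta> x y + cov_form D \<eta> y x"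

definition nijenhuis ::
    "'a endo_field \<Rightarrow> 'a vfield \<Rightarrow> 'a one_form \<Rightarrow> 'a connection \<Rightarrow>
     'a vfield \<Rightarrow> 'a vfield \<Rightarrow> 'a vfield" where
  "nijenhuis \<phi> \<xi> \<eta> D x y = phi_phi_bracket lie_bracket \<phi> x y - d_form D \<eta> x y *\<^sub>F \<xi>"

definition assoc_nijenhuis ::
    "'a endo_field \<Rightarrow> 'a vfield \<Rightarrow> 'a one_form \<Rightarrow> 'a connection \<Rightarrow>
     'a vfield \<Rightarrow> 'a vfield \<Rightarrow> 'a vfield" where
  "assoc_nijenhuis \<phi> \<xi> \<eta> D x y =
     phi_phi_bracket (sym_bracket D) \<phi> x y - lie_metric D \<eta> x y *\<^sub>F \<xi>"

definition lower :: "'a bilin_field \<Rightarrow> ('a vfield \<Rightarrow> 'a vfield \<Rightarrow> 'a vfield) \<Rightarrow>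
     'a vfield \<Rightarrow> 'a vfield \<Rightarrow> 'a vfield \<Rightarrow> 'a \<Rightarrow> real" where
  "lower g T x y z = field_pairing g (T x y) z"

end

theory Submission
  imports Defs
begin

text \<open>
  The Lie bracket and the symmetric bracket add up to twice the covariant derivative, because the
  connection is torsion free. Hence \<open>N + N'\<close>, where \<open>N'\<close> is the associated Nijenhuis tensor, is
  twice the expression that \<open>N\<close> becomes when \<open>[x, y]\<close> is replaced by \<open>\<nabla>\<^sub>x y\<close> and \<open>d\<eta>(x, y)\<close> by
  \<open>(\<nabla>\<^sub>x \<eta>) y\<close>. Since \<open>\<phi>\<close> is self-adjoint, lowering the index gives (lemma \<open>lower_nijenhuis_sum\<close>)

  \<open>(N + N')(x, y, z) = 2 (F(\<phi> x, y, z) - F(x, y, \<phi> z) - (\<nabla>\<^sub>x \<eta>)(y) \<eta>(z))\<close>.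

  Apart from \<open>N'(\<xi>, \<xi>, \<phi> y)\<close>, the theorem involves only this combination.

  To solve for \<open>F\<close>, put \<open>\<phi> x\<close> for \<open>x\<close> and symmetrise in \<open>y\<close> and \<open>z\<close>. The tensor \<open>F\<close> is symmetric in
  its last two arguments (\<open>F_commute\<close>), and differentiating \<open>\<phi>\<^sup>2 = I - \<eta> \<otimes> \<xi>\<close> shows that the unwanted
  terms \<open>F(\<phi> x, y, \<phi> z) + F(\<phi> x, \<phi> y, z)\<close> cancel against the terms in \<open>\<nabla>\<eta>\<close> (\<open>F_\<phi>\<close>). What remains
  is \<open>4 F(\<phi>\<^sup>2 x, y, z) = 4 F(x, y, z) - 4 \<eta>(x) F(\<xi>, y, z)\<close>.

  The missing \<open>F(\<xi>, y, z)\<close> is found by putting \<open>x = \<xi>\<close> and \<open>\<phi> z\<close> for \<open>z\<close>: as \<open>\<phi> \<xi> = 0\<close> and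
  \<open>\<eta> \<circ> \<phi> = 0\<close>, only \<open>- 2 F(\<xi>, y, \<phi>\<^sup>2 z) = - 2 F(\<xi>, y, z) + 2 \<eta>(z) F(\<xi>, y, \<xi>)\<close> is left. The last term
  is compensated by \<open>N'(\<xi>, \<xi>, \<phi> y) = - 2 F(\<xi>, y, \<xi>)\<close>, both sides being \<open>2 g(\<nabla>\<^sub>\<xi> \<xi>, \<phi> y)\<close>.

  The identities hold pointwise, but the connection acts on fields: replacing \<open>x\<close> by
  \<open>\<phi>\<^sup>2 x + \<eta>(x) \<xi>\<close> inside \<open>\<nabla>\<close> needs \<open>\<eta>(x) \<xi>\<close> to be a vector field, which is why differences of
  smooth functions are studied first.
\<close>

section \<open>Vector fields form a group under subtraction\<close>

text \<open>The function \<open>w\<close> is only required to agree with the difference on \<open>U\<close>, since the directional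
  derivatives of a difference split only at points of \<open>U\<close>; this makes the induction go through.\<close>

lemma Ck_on_diff:
  assumes "open U" "Ck_on k U f" "Ck_on k U h" "\<And>x. x \<in> U \<Longrightarrow> w x = f x - h x"
  shows "Ck_on k U w"
  using assms(2-)
proof (induction k arbitrary: f h w)
  case 0
  have "continuous_on U (\<lambda>x. f x - h x)"
    using 0 by (auto intro: continuous_on_diff)
  then show ?case
    using 0(3) by (simp cong: continuous_on_cong)
next
  case (Suc k)
  have deriv: "(w has_derivative
      (\<lambda>v. frechet_derivative f (at x) v - frechet_derivative h (at x) v)) (at x)" if "x \<in> U" for x
  proof (rule has_derivative_transform_within_open[OF _ assms(1) that])
    show "((\<lambda>x. f x - h x) has_derivative
        (\<lambda>v. frechet_derivative f (at x) v - frechet_derivative h (at x) v)) (at x)"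
      using Suc.prems(1,2) that
      by (intro has_derivative_diff) (auto simp: frechet_derivative_works)
  qed (simp add: Suc.prems(3))
  have "Ck_on k U (\<lambda>x. frechet_derivative w (at x) v)" for v
  proof (rule Suc.IH)
    show "Ck_on k U (\<lambda>x. frechet_derivative f (at x) v)"
      "Ck_on k U (\<lambda>x. frechet_derivative h (at x) v)"
      using Suc.prems by auto
    show "frechet_derivative w (at x) v
        = frechet_derivative f (at x) v - frechet_derivative h (at x) v" if "x \<in> U" for x
      using frechet_derivative_at[OF deriv[OF that]] by metis
  qed
  then show ?case
    using deriv by (auto simp: differentiable_def)
qed

lemma smooth_functions_diff:
  assumes "smooth_atlas \<A>" "f \<in> smooth_functions \<A>" "h \<in> smooth_functions \<A>"
  shows "(\<lambda>q. f q - h q) \<in> smooth_functions \<A>"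
proof -
  have "smooth_on (c ` U) ((\<lambda>q. f q - h q) \<circ> inv_into U c)" if "(U, c) \<in> \<A>" for U c
  proof -
    have "open (c ` U)"
      using assms(1) that by (auto simp: smooth_atlas_def)
    moreover have "smooth_on (c ` U) (f \<circ> inv_into U c)" "smooth_on (c ` U) (h \<circ> inv_into U c)"
      using assms(2,3) that by (auto simp: smooth_functions_def)
    ultimately show ?thesis
      unfolding smooth_on_def
      by (auto intro: Ck_on_diff[of _ _ "f \<circ> inv_into U c" "h \<circ> inv_into U c"])
  qed
  then show ?thesis
    by (auto simp: smooth_functions_def)
qed

lemma subspace_tangent_space: "subspace (tangent_space \<A> p)"
  by (auto simp: subspace_def tangent_space_def scaleR_fun_def plus_fun_def zero_fun_def
      algebra_simps)

lemma vector_fields_diff: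
  assumes "smooth_atlas \<A>" "X \<in> vector_fields \<A>" "Y \<in> vector_fields \<A>"
  shows "X - Y \<in> vector_fields \<A>"
proof -
  have "vderiv (X - Y) f = (\<lambda>p. vderiv X f p - vderiv Y f p)" for f
    by (simp add: vderiv_def)
  moreover have "(X - Y) p \<in> tangent_space \<A> p" for p
    using assms subspace_diff[OF subspace_tangent_space, of "X p" \<A> p "Y p"]
    by (simp add: vector_fields_def)
  ultimately show ?thesis
    using assms smooth_functions_diff[OF assms(1)] by (simp add: vector_fields_def)
qed

lemma linear_map_on_diff:
  assumes "linear_map_on V L" "subspace V" "u \<in> V" "v \<in> V"
  shows "L (u - v) = L u - L v"
proof -
  have "L (u - v) + L v = L u"
    using assms unfolding linear_map_on_def by (metis diff_add_cancel subspace_diff)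
  then show ?thesis
    by (simp add: eq_diff_eq)
qed

lemma app_field_apply [simp]: "(T \<rhd> X) p = T p (X p)"
  by (simp add: app_field_def)


section \<open>Pointwise algebra of the structure\<close>

locale almost_paracontact_paracomplex_manifold =
  fixes \<A> :: "('a::{t2_space, second_countable_topology}, 'e::euclidean_space) atlas"
    and \<phi> :: "'a endo_field" and \<xi> :: "'a vfield" and \<eta> :: "'a one_form"
    and g :: "'a bilin_field" and D :: "'a connection"
    and n :: nat
  assumes apapr: "almost_paracontact_paracomplex_riemannian n \<A> \<phi> \<xi> \<eta> g"
    and levi_civita: "levi_civita \<A> g D"
begin

abbreviation "VF \<equiv> vector_fields \<A>"
abbreviation "T \<equiv> tangent_space \<A>"
abbreviation "F \<equiv> fundamental_tensor \<phi> g D"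
abbreviation "N \<equiv> nijenhuis \<phi> \<xi> \<eta> D"
abbreviation "N_assoc \<equiv> assoc_nijenhuis \<phi> \<xi> \<eta> D"

lemma atlas: "smooth_atlas \<A>"
  and \<xi>_VF [simp]: "\<xi> \<in> VF"
  and \<phi>_\<xi> [simp]: "\<phi> p (\<xi> p) = 0"
  and \<eta>_\<xi> [simp]: "\<eta> p (\<xi> p) = 1"
  and \<phi>_\<phi>: "u \<in> T p \<Longrightarrow> \<phi> p (\<phi> p u) = u - \<eta> p u *\<^sub>R \<xi> p"
  and \<eta>_\<phi> [simp]: "u \<in> T p \<Longrightarrow> \<eta> p (\<phi> p u) = 0"
  and g_\<xi> [simp]: "u \<in> T p \<Longrightarrow> g p u (\<xi> p) = \<eta> p u"
  and g_\<phi>_\<phi>: "u \<in> T p \<Longrightarrow> v \<in> T p \<Longrightarrow> g p (\<phi> p u) (\<phi> p v) = g p u v - \<eta> p u * \<eta> p v"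
  using apapr by (auto simp: almost_paracontact_paracomplex_riemannian_def)

lemma \<phi>_linear: "linear_map_on (T p) (\<phi> p)"
  and \<phi>_T [simp]: "u \<in> T p \<Longrightarrow> \<phi> p u \<in> T p"
  and \<phi>_VF [simp]: "X \<in> VF \<Longrightarrow> \<phi> \<rhd> X \<in> VF"
  using apapr by (auto simp: almost_paracontact_paracomplex_riemannian_def endo_fields_def)

lemma \<eta>_smooth: "X \<in> VF \<Longrightarrow> \<eta> \<rhd> X \<in> smooth_functions \<A>"
  using apapr by (auto simp: almost_paracontact_paracomplex_riemannian_def one_forms_def)

lemma g_linear: "u \<in> T p \<Longrightarrow> linear_map_on (T p) (g p u)"
  and g_commute: "u \<in> T p \<Longrightarrow> v \<in> T p \<Longrightarrow> g p u v = g p v u"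
  using apapr
  by (auto simp: almost_paracontact_paracomplex_riemannian_def riemannian_metric_def)

lemma D_VF [simp]: "X \<in> VF \<Longrightarrow> Y \<in> VF \<Longrightarrow> D X Y \<in> VF"
  and D_add_left: "X \<in> VF \<Longrightarrow> Y \<in> VF \<Longrightarrow> Z \<in> VF \<Longrightarrow> D (X + Y) Z = D X Z + D Y Z"
  and D_add_right: "X \<in> VF \<Longrightarrow> Y \<in> VF \<Longrightarrow> Z \<in> VF \<Longrightarrow> D X (Y + Z) = D X Y + D X Z"
  and D_scale_left: "f \<in> smooth_functions \<A> \<Longrightarrow> X \<in> VF \<Longrightarrow> Y \<in> VF \<Longrightarrow> D (f *\<^sub>F X) Y = f *\<^sub>F D X Y"
  and D_scale_right: "f \<in> smooth_functions \<A> \<Longrightarrow> X \<in> VF \<Longrightarrow> Y \<in> VF \<Longrightarrow>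
    D X (f *\<^sub>F Y) = vderiv X f *\<^sub>F Y + f *\<^sub>F D X Y"
  using levi_civita by (auto simp: levi_civita_def affine_connection_def)

lemma torsion_free: "X \<in> VF \<Longrightarrow> Y \<in> VF \<Longrightarrow> lie_bracket X Y = D X Y - D Y X"
  using levi_civita by (auto simp: levi_civita_def)

lemma metric_compatible:
  "X \<in> VF \<Longrightarrow> Y \<in> VF \<Longrightarrow> Z \<in> VF \<Longrightarrow>
    vderiv X (field_pairing g Y Z) p = g p (D X Y p) (Z p) + g p (Y p) (D X Z p)"
  using levi_civita by (auto simp: levi_civita_def field_pairing_def)

lemma VF_T [simp]: "X \<in> VF \<Longrightarrow> X p \<in> T p"
  by (simp add: vector_fields_def)

lemma T_closed [simp]:
  "u \<in> T p \<Longrightarrow> v \<in> T p \<Longrightarrow> u + v \<in> T p"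
  "u \<in> T p \<Longrightarrow> v \<in> T p \<Longrightarrow> u - v \<in> T p"
  "u \<in> T p \<Longrightarrow> a *\<^sub>R u \<in> T p"
  using subspace_tangent_space[of \<A> p] by (auto intro: subspace_add subspace_diff subspace_scale)

lemma T_zero [simp]: "0 \<in> T p"
  using subspace_tangent_space by (rule subspace_0)

lemma \<phi>_simps:
  "u \<in> T p \<Longrightarrow> v \<in> T p \<Longrightarrow> \<phi> p (u + v) = \<phi> p u + \<phi> p v"
  "u \<in> T p \<Longrightarrow> v \<in> T p \<Longrightarrow> \<phi> p (u - v) = \<phi> p u - \<phi> p v"
  "u \<in> T p \<Longrightarrow> \<phi> p (a *\<^sub>R u) = a *\<^sub>R \<phi> p u"
  using \<phi>_linear[of p] linear_map_on_diff[OF \<phi>_linear subspace_tangent_space]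
  by (auto simp: linear_map_on_def)

lemma g_simps_right:
  assumes "w \<in> T p"
  shows "u \<in> T p \<Longrightarrow> v \<in> T p \<Longrightarrow> g p w (u + v) = g p w u + g p w v"
    "u \<in> T p \<Longrightarrow> v \<in> T p \<Longrightarrow> g p w (u - v) = g p w u - g p w v"
    "u \<in> T p \<Longrightarrow> g p w (a *\<^sub>R u) = a * g p w u"
  using g_linear[OF assms] linear_map_on_diff[OF g_linear[OF assms] subspace_tangent_space]
  by (auto simp: linear_map_on_def)

lemma g_simps_left:
  assumes "w \<in> T p"
  shows "u \<in> T p \<Longrightarrow> v \<in> T p \<Longrightarrow> g p (u + v) w = g p u w + g p v w"
    "u \<in> T p \<Longrightarrow> v \<in> T p \<Longrightarrow> g p (u - v) w = g p u w - g p v w"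
    "u \<in> T p \<Longrightarrow> g p (a *\<^sub>R u) w = a * g p u w"
  using g_simps_right[OF assms] assms by (simp_all add: g_commute[of _ p w])

lemma \<phi>_zero [simp]: "\<phi> p 0 = 0"
  using \<phi>_simps(3)[of 0 p 0] by simp

lemma g_zero_left [simp]: "w \<in> T p \<Longrightarrow> g p 0 w = 0"
  using g_simps_left(3)[of w p 0 0] by simp

lemma g_\<xi>_left [simp]: "u \<in> T p \<Longrightarrow> g p (\<xi> p) u = \<eta> p u"
  using g_commute[of "\<xi> p" p u] by simp

text \<open>\<open>\<phi>\<close> is an involution of the complement of \<open>\<xi>\<close> that preserves \<open>g\<close>, hence self-adjoint; formally,
  replace \<open>u\<close> by \<open>\<phi> u\<close> in the compatibility of \<open>\<phi>\<close> and \<open>g\<close>.\<close>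

lemma \<phi>_self_adjoint:
  assumes "u \<in> T p" "v \<in> T p"
  shows "g p (\<phi> p u) v = g p u (\<phi> p v)"
  using g_\<phi>_\<phi>[of "\<phi> p u" p v] assms by (simp add: \<phi>_\<phi> g_simps_left)

lemma zero_VF [simp]: "0 \<in> VF"
  using vector_fields_diff[OF atlas \<xi>_VF \<xi>_VF] by simp

lemma D_zero [simp]:
  assumes "X \<in> VF"
  shows "D 0 X = 0" "D X 0 = 0"
  using D_add_left[of 0 0 X] D_add_right[of X 0 0] assms by simp_all

lemma \<phi>_field_\<xi> [simp]: "\<phi> \<rhd> \<xi> = 0"
  by (rule ext) simp

lemma \<phi>_\<phi>_field: "X \<in> VF \<Longrightarrow> (\<phi> \<rhd> \<phi> \<rhd> X) + (\<eta> \<rhd> X) *\<^sub>F \<xi> = X"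
  by (rule ext) (simp add: \<phi>_\<phi> fscale_def)

text \<open>The axioms of a connection apply to \<open>\<eta>(X) \<xi>\<close> only once this is known to be a vector field. It is
  one because it is the difference of \<open>X\<close> and \<open>\<phi>\<^sup>2 X\<close>.\<close>

lemma \<eta>_\<xi>_VF:
  assumes "X \<in> VF"
  shows "(\<eta> \<rhd> X) *\<^sub>F \<xi> \<in> VF"
proof -
  have "(\<eta> \<rhd> X) *\<^sub>F \<xi> = X - (\<phi> \<rhd> \<phi> \<rhd> X)"
    using \<phi>_\<phi>_field[OF assms] by (metis add_diff_cancel_left')
  then show ?thesis
    using vector_fields_diff[OF atlas] assms by simp
qed


section \<open>The fundamental tensor\<close>

lemma F_eq:
  assumes "x \<in> VF" "y \<in> VF" "z \<in> VF"
  shows "F x y z p = g p (D x (\<phi> \<rhd> y) p) (z p) - g p (D x y p) (\<phi> p (z p))"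
  using assms
  by (simp add: fundamental_tensor_def field_pairing_def cov_endo_def g_simps_left \<phi>_self_adjoint)

lemma F_zero_left:
  assumes "y \<in> VF" "z \<in> VF"
  shows "F 0 y z p = 0"
  using assms by (simp add: fundamental_tensor_def cov_endo_def field_pairing_def)

text \<open>The covariant derivative of a self-adjoint field of endomorphisms is self-adjoint.\<close>

lemma F_commute:
  assumes "x \<in> VF" "y \<in> VF" "z \<in> VF"
  shows "F x y z p = F x z y p"
proof -
  have "field_pairing g (\<phi> \<rhd> y) z = field_pairing g y (\<phi> \<rhd> z)"
    using assms by (simp add: fun_eq_iff field_pairing_def \<phi>_self_adjoint)
  then have "vderiv x (field_pairing g (\<phi> \<rhd> y) z) p = vderiv x (field_pairing g y (\<phi> \<rhd> z)) p"
    by simp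
  then show ?thesis
    using assms
    by (simp add: metric_compatible F_eq g_commute[of "y p" p] g_commute[of "\<phi> p (y p)" p])
qed

text \<open>\<open>\<eta>\<close> is dual to \<open>\<xi>\<close> and \<open>\<nabla>\<close> respects the metric duality.\<close>

lemma cov_form_\<eta>:
  assumes "x \<in> VF" "y \<in> VF"
  shows "cov_form D \<eta> x y p = g p (D x \<xi> p) (y p)"
proof -
  have "\<eta> \<rhd> y = field_pairing g y \<xi>"
    using assms by (simp add: fun_eq_iff field_pairing_def)
  then show ?thesis
    using assms metric_compatible[of x y \<xi> p] g_commute[of "y p" p "D x \<xi> p"]
    by (simp add: cov_form_def)
qed

text \<open>This is \<open>\<phi>\<^sup>2 = I - \<eta> \<otimes> \<xi>\<close> differentiated along \<open>x\<close>: the terms \<open>\<nabla>\<^sub>x y\<close> cancel, and the derivative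
  of \<open>\<eta>(y)\<close> only survives in the combination \<open>(\<nabla>\<^sub>x \<eta>)(y)\<close>.\<close>

lemma F_\<phi>:
  assumes "x \<in> VF" "y \<in> VF" "z \<in> VF"
  shows "F x (\<phi> \<rhd> y) z p + F x y (\<phi> \<rhd> z) p
    = - cov_form D \<eta> x y p * \<eta> p (z p) - \<eta> p (y p) * cov_form D \<eta> x z p"
proof -
  have "D x y = D x ((\<phi> \<rhd> \<phi> \<rhd> y) + (\<eta> \<rhd> y) *\<^sub>F \<xi>)"
    using \<phi>_\<phi>_field[OF assms(2)] by simp
  also have "\<dots> = D x (\<phi> \<rhd> \<phi> \<rhd> y) + (vderiv x (\<eta> \<rhd> y) *\<^sub>F \<xi> + (\<eta> \<rhd> y) *\<^sub>F D x \<xi>)"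
    using assms by (simp add: D_add_right D_scale_right \<eta>_smooth \<eta>_\<xi>_VF)
  finally have "D x (\<phi> \<rhd> \<phi> \<rhd> y) p
      = D x y p - (vderiv x (\<eta> \<rhd> y) p *\<^sub>R \<xi> p + \<eta> p (y p) *\<^sub>R D x \<xi> p)"
    by (simp add: fscale_def)
  then have "g p (D x (\<phi> \<rhd> \<phi> \<rhd> y) p) (z p) = g p (D x y p) (z p)
      - (vderiv x (\<eta> \<rhd> y) p * \<eta> p (z p) + \<eta> p (y p) * cov_form D \<eta> x z p)"
    using assms by (simp add: g_simps_left cov_form_\<eta>)
  then show ?thesis
    using assms by (simp add: F_eq \<phi>_\<phi> g_simps_right cov_form_def algebra_simps)
qed

text \<open>\<open>F\<close> is tensorial in its first argument, and \<open>\<phi>\<^sup>2 x = x - \<eta>(x) \<xi>\<close>.\<close>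

lemma F_\<phi>_\<phi>:
  assumes "x \<in> VF" "y \<in> VF" "z \<in> VF"
  shows "F (\<phi> \<rhd> \<phi> \<rhd> x) y z p = F x y z p - \<eta> p (x p) * F \<xi> y z p"
proof -
  have *: "D x w p = D (\<phi> \<rhd> \<phi> \<rhd> x) w p + \<eta> p (x p) *\<^sub>R D \<xi> w p" if "w \<in> VF" for w
  proof -
    have "D x w = D ((\<phi> \<rhd> \<phi> \<rhd> x) + (\<eta> \<rhd> x) *\<^sub>F \<xi>) w"
      using \<phi>_\<phi>_field[OF assms(1)] by simp
    also have "\<dots> = D (\<phi> \<rhd> \<phi> \<rhd> x) w + (\<eta> \<rhd> x) *\<^sub>F D \<xi> w"
      using assms that by (simp add: D_add_left D_scale_left \<eta>_smooth \<eta>_\<xi>_VF)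
    finally show ?thesis
      by (simp add: fscale_def)
  qed
  show ?thesis
    using assms by (simp add: F_eq *[of y] *[of "\<phi> \<rhd> y"] g_simps_left algebra_simps)
qed


section \<open>Recovering the fundamental tensor from the Nijenhuis tensors\<close>

lemma lower_nijenhuis_sum:
  assumes "x \<in> VF" "y \<in> VF" "z \<in> VF"
  shows "lower g N x y z p + lower g N_assoc x y z p
    = 2 * (F (\<phi> \<rhd> x) y z p - F x y (\<phi> \<rhd> z) p - cov_form D \<eta> x y p * \<eta> p (z p))"
  using assms
  by (simp add: lower_def field_pairing_def nijenhuis_def assoc_nijenhuis_def phi_phi_bracket_def
      torsion_free sym_bracket_def d_form_def lie_metric_def fscale_def F_eq g_simps_left \<phi>_simps
      \<phi>_self_adjoint algebra_simps)

text \<open>\<open>F_\<phi>\<close> at \<open>(\<phi> x, y, z)\<close> trades the terms with \<open>\<phi>\<close> in the second or third place for terms in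
  \<open>\<nabla>\<eta>\<close>, which the symmetrisation of \<open>lower_nijenhuis_sum\<close> contributes with the opposite sign.\<close>

lemma nijenhuis_symmetrised:
  assumes "x \<in> VF" "y \<in> VF" "z \<in> VF"
  shows "lower g N (\<phi> \<rhd> x) y z p + lower g N (\<phi> \<rhd> x) z y p
      + lower g N_assoc (\<phi> \<rhd> x) y z p + lower g N_assoc (\<phi> \<rhd> x) z y p
    = 4 * (F x y z p - \<eta> p (x p) * F \<xi> y z p)"
  using assms lower_nijenhuis_sum[of "\<phi> \<rhd> x" y z p] lower_nijenhuis_sum[of "\<phi> \<rhd> x" z y p]
    F_commute[of "\<phi> \<rhd> x" "\<phi> \<rhd> y" z p] F_commute[of x y z p] F_commute[of \<xi> y z p]
    F_\<phi>[of "\<phi> \<rhd> x" y z p]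
  by (simp add: F_\<phi>_\<phi> algebra_simps)

text \<open>All covariant derivatives of \<open>\<phi> \<xi> = 0\<close> drop out of \<open>N'(\<xi>,\<xi>)\<close>, and pairing with \<open>\<phi> y\<close> removes
  the multiples of \<open>\<xi>\<close>, so that only \<open>2 g(\<nabla>\<^sub>\<xi> \<xi>, \<phi> y)\<close> is left.\<close>

lemma assoc_nijenhuis_\<xi>_\<xi>:
  assumes "y \<in> VF"
  shows "lower g N_assoc \<xi> \<xi> (\<phi> \<rhd> y) p = - 2 * F \<xi> y \<xi> p"
proof -
  \<comment> \<open>The simplifier collects \<open>v + v\<close> to a product with a numeral function, which is not a scaling.\<close>
  have double: "2 * v = 2 *\<^sub>R v" for v :: "'a tvec"
    by (simp only: mult_2 scaleR_2)
  have "lower g N_assoc \<xi> \<xi> (\<phi> \<rhd> y) p = 2 * g p (D \<xi> \<xi> p) (\<phi> p (y p))"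
    using assms
    by (simp add: lower_def field_pairing_def assoc_nijenhuis_def phi_phi_bracket_def
        sym_bracket_def lie_metric_def fscale_def g_simps_left \<phi>_simps \<phi>_\<phi> double)
  moreover have "F \<xi> y \<xi> p = - g p (D \<xi> \<xi> p) (\<phi> p (y p))"
    using F_commute[of \<xi> y \<xi> p] assms by (simp add: F_eq)
  ultimately show ?thesis
    by simp
qed

lemma nijenhuis_\<xi>:
  assumes "y \<in> VF" "z \<in> VF"
  shows "lower g N \<xi> y (\<phi> \<rhd> z) p + lower g N_assoc \<xi> y (\<phi> \<rhd> z) p
    = - 2 * (F \<xi> y z p - \<eta> p (z p) * F \<xi> y \<xi> p)"
proof -
  have "F \<xi> y (\<phi> \<rhd> \<phi> \<rhd> z) p = F \<xi> y z p - \<eta> p (z p) * F \<xi> y \<xi> p"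
    using assms by (simp add: fundamental_tensor_def field_pairing_def cov_endo_def \<phi>_\<phi>
        g_simps_right)
  then show ?thesis
    using assms lower_nijenhuis_sum[of \<xi> y "\<phi> \<rhd> z" p]
    by (simp add: F_zero_left)
qed

end

theorem theorem7p1:
  fixes \<A> :: "('a::{t2_space, second_countable_topology}, 'e::euclidean_space) atlas"
    and \<phi> :: "'a endo_field" and \<xi> :: "'a vfield" and \<eta> :: "'a one_form"
    and g :: "'a bilin_field" and D :: "'a connection"
    and n :: nat and x y z :: "'a vfield" and p :: 'a
  assumes "almost_paracontact_paracomplex_riemannian n \<A> \<phi> \<xi> \<eta> g"
    and "levi_civita \<A> g D"
    and "x \<in> vector_fields \<A>" "y \<in> vector_fields \<A>" "z \<in> vector_fields \<A>"
  shows "fundamental_tensor \<phi> g D x y z p =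
      1/4 * (lower g (nijenhuis \<phi> \<xi> \<eta> D) (\<phi> \<rhd> x) y z p
           + lower g (nijenhuis \<phi> \<xi> \<eta> D) (\<phi> \<rhd> x) z y p
           + lower g (assoc_nijenhuis \<phi> \<xi> \<eta> D) (\<phi> \<rhd> x) y z p
           + lower g (assoc_nijenhuis \<phi> \<xi> \<eta> D) (\<phi> \<rhd> x) z y p)
    - 1/2 * \<eta> p (x p) *
          (lower g (nijenhuis \<phi> \<xi> \<eta> D) \<xi> y (\<phi> \<rhd> z) p
         + lower g (assoc_nijenhuis \<phi> \<xi> \<eta> D) \<xi> y (\<phi> \<rhd> z) p
         + \<eta> p (z p) * lower g (assoc_nijenhuis \<phi> \<xi> \<eta> D) \<xi> \<xi> (\<phi> \<rhd> y) p)"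
proof -
  interpret almost_paracontact_paracomplex_manifold \<A> \<phi> \<xi> \<eta> g D n
    using assms(1,2) by unfold_locales
  show ?thesis
    unfolding nijenhuis_symmetrised[OF assms(3-5)] nijenhuis_\<xi>[OF assms(4,5)]
      assoc_nijenhuis_\<xi>_\<xi>[OF assms(4)]
    by (simp add: algebra_simps)
qed

end
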